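(* Let $L(k)$ be one of $L^-_C(k)$, $L^+_C(k)$, $L^-_D(k)$ or $L^+_D(k)$ (the same choice for all $k$), and let $R(k)=k\,L(k)^{1/k}$. Then the limit $R=\lim_{k\to\infty}R(k)$ exists and is equal to $\sup_{k\geq 1}R(k)$.
   Context: A circulant graph is a Cayley graph $\mathrm{Cay}(\mathbb{Z}_n,S)$ of a cyclic group ($0\notin S$, arc from $g$ to $g+s$ for $s\in S$), of degree $|S|$; it is undirected if $S=-S$. $CC(d,k)$ (resp. $DCC(d,k)$) denotes the largest order of an undirected (resp. directed) circulant graph with degree $d$ and diameter $k$. $L^-_C(k)=\liminf_{d\to\infty}CC(d,k)/d^k$, $L^+_C(k)=\limsup_{d\to\infty}CC(d,k)/d^k$, $L^-_D(k)=\liminf_{d\to\infty}DCC(d,k)/d^k$, $L^+_D(k)=\limsup_{d\to\infty}DCC(d,k)/d^k$. *)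

theory Defs
  imports Complex_Main "HOL-Library.Extended_Real" "HOL-Algebra.Elementary_Groups"
    "Graph_Theory.Pair_Digraph" "Graph_Theory.Shortest_Path"
begin

definition cayley_digraph :: "('a, 'b) monoid_scheme \<Rightarrow> 'a set \<Rightarrow> 'a pair_pre_digraph" where
  "cayley_digraph G S =
     \<lparr>pverts = carrier G, parcs = {(g, g \<otimes>\<^bsub>G\<^esub> s) | g s. g \<in> carrier G \<and> s \<in> S}\<rparr>"

text \<open>With unit arc weights, \<open>wf_digraph.\<mu>\<close> is the directed distance, which is \<open>\<infinity>\<close> if there
  is no walk. A digraph that is not strongly connected therefore has infinite diameter.\<close>

definition digraph_diameter :: "('a, 'b) pre_digraph \<Rightarrow> ereal" where
  "digraph_diameter G = (SUP u\<in>verts G. SUP v\<in>verts G. wf_digraph.\<mu> G (\<lambda>_. 1) u v)"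

text \<open>A directed circulant graph has an arbitrary connection set; symmetric ones are not excluded.
  The case \<open>n = 0\<close> is excluded because \<open>integer_mod_group 0\<close> is the infinite cyclic group.\<close>

definition directed_circulant_orders :: "nat \<Rightarrow> nat \<Rightarrow> nat set" where
  "directed_circulant_orders d k =
     {n. n \<ge> 1 \<and> (\<exists>S. S \<subseteq> carrier (integer_mod_group n) - {0} \<and> card S = d \<and>
        digraph_diameter (cayley_digraph (integer_mod_group n) S) = ereal (real k))}"

definition undirected_circulant_orders :: "nat \<Rightarrow> nat \<Rightarrow> nat set" where
  "undirected_circulant_orders d k =
     {n. n \<ge> 1 \<and> (\<exists>S. S \<subseteq> carrier (integer_mod_group n) - {0} \<and>
        S = m_inv (integer_mod_group n) ` S \<and> card S = d \<and>
        digraph_diameter (cayley_digraph (integer_mod_group n) S) = ereal (real k))}"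

text \<open>Both sets of orders are finite (see below), so \<open>Sup\<close> is the maximum, with the value \<open>0\<close>
  when no such graph exists; for fixed \<open>k \<ge> 1\<close> that happens for only finitely many \<open>d\<close>.\<close>

definition CC :: "nat \<Rightarrow> nat \<Rightarrow> nat" where
  "CC d k = Sup (undirected_circulant_orders d k)"

definition DCC :: "nat \<Rightarrow> nat \<Rightarrow> nat" where
  "DCC d k = Sup (directed_circulant_orders d k)"

definition LC_minus :: "nat \<Rightarrow> ereal" where
  "LC_minus k = liminf (\<lambda>d. ereal (real (CC d k) / real d ^ k))"

definition LC_plus :: "nat \<Rightarrow> ereal" where
  "LC_plus k = limsup (\<lambda>d. ereal (real (CC d k) / real d ^ k))"

definition LD_minus :: "nat \<Rightarrow> ereal" where
  "LD_minus k = liminf (\<lambda>d. ereal (real (DCC d k) / real d ^ k))"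

definition LD_plus :: "nat \<Rightarrow> ereal" where
  "LD_plus k = limsup (\<lambda>d. ereal (real (DCC d k) / real d ^ k))"

text \<open>The following facts show that \<open>CC\<close> and \<open>DCC\<close> are maxima and that the four
  limits are nonnegative and finite, so that \<open>real_of_ereal\<close> loses nothing on them.\<close>

lemma wf_digraph_cayley:
  assumes "group G" "S \<subseteq> carrier G"
  shows "wf_digraph (with_proj (cayley_digraph G S))"
  using assms by unfold_locales (auto simp: cayley_digraph_def intro!: monoid.m_closed group.is_monoid)

lemma awalk_cayley_foldl:
  assumes G: "group G" and S: "S \<subseteq> carrier G"
    and "pre_digraph.awalk (with_proj (cayley_digraph G S)) u p v" "length p \<le> k"
  shows "\<exists>xs. set xs \<subseteq> insert \<one>\<^bsub>G\<^esub> S \<and> length xs = k \<and> v = foldl (\<otimes>\<^bsub>G\<^esub>) u xs"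
  using assms(3,4)
proof (induction p arbitrary: u k)
  case Nil
  interpret wf_digraph "with_proj (cayley_digraph G S)"
    using G S by (rule wf_digraph_cayley)
  have "u = v" "u \<in> verts (cayley_digraph G S)" using Nil by (auto simp: awalk_Nil_iff)
  then have "u = v" "u \<in> carrier G" by (auto simp: cayley_digraph_def)
  moreover have "foldl (\<otimes>\<^bsub>G\<^esub>) u (replicate k \<one>\<^bsub>G\<^esub>) = u"
    using \<open>u \<in> carrier G\<close> G by (induction k) (auto simp: monoid.r_one group.is_monoid)
  ultimately show ?case by (intro exI[of _ "replicate k \<one>\<^bsub>G\<^esub>"]) auto
next
  case (Cons e p)
  interpret wf_digraph "with_proj (cayley_digraph G S)"
    using G S by (rule wf_digraph_cayley)
  obtain j where j: "k = Suc j" "length p \<le> j" using Cons.prems(2) by (cases k) auto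
  have e: "e \<in> parcs (cayley_digraph G S)" "u = fst e" "awalk (snd e) p v"
    using Cons.prems(1) by (auto simp: awalk_Cons_iff)
  then obtain s where s: "s \<in> S" "snd e = u \<otimes>\<^bsub>G\<^esub> s" by (auto simp: cayley_digraph_def)
  from Cons.IH[OF e(3) j(2)] obtain xs where
    "set xs \<subseteq> insert \<one>\<^bsub>G\<^esub> S" "length xs = j" "v = foldl (\<otimes>\<^bsub>G\<^esub>) (snd e) xs" by blast
  then show ?case using s j by (intro exI[of _ "s # xs"]) auto
qed

lemma order_cayley_le:
  assumes G: "group G" and S: "S \<subseteq> carrier G" "finite S"
    and diam: "digraph_diameter (cayley_digraph G S) = ereal (real k)"
  shows "card (carrier G) \<le> Suc (card S) ^ k"
proof -
  interpret wf_digraph "with_proj (cayley_digraph G S)"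
    using G S(1) by (rule wf_digraph_cayley)
  let ?X = "{xs. set xs \<subseteq> insert \<one>\<^bsub>G\<^esub> S \<and> length xs = k}"
  have "carrier G \<subseteq> foldl (\<otimes>\<^bsub>G\<^esub>) \<one>\<^bsub>G\<^esub> ` ?X"
  proof
    fix v assume v: "v \<in> carrier G"
    have one: "\<one>\<^bsub>G\<^esub> \<in> carrier G" using G by (simp add: group.is_monoid monoid.one_closed)
    have "\<mu> (\<lambda>_. 1) \<one>\<^bsub>G\<^esub> v \<le> digraph_diameter (cayley_digraph G S)"
      unfolding digraph_diameter_def using v one
      by (intro SUP_upper2[of "\<one>\<^bsub>G\<^esub>"] SUP_upper) (auto simp: cayley_digraph_def)
    also have "\<dots> < ereal (real (Suc k))" by (simp add: diam)
    finally obtain p where p: "awalk \<one>\<^bsub>G\<^esub> p v" "awalk_cost (\<lambda>_. 1) p < real (Suc k)"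
      unfolding \<mu>_def INF_less_iff by auto
    have "awalk_cost (\<lambda>_. 1) p = real (length p)" by (induction p) auto
    with p have "length p \<le> k" by simp
    from awalk_cayley_foldl[OF G S(1) p(1) this] show "v \<in> foldl (\<otimes>\<^bsub>G\<^esub>) \<one>\<^bsub>G\<^esub> ` ?X"
      by auto
  qed
  moreover have fin: "finite ?X" using S(2) by (intro finite_lists_length_eq) simp
  ultimately have "card (carrier G) \<le> card ?X" by (rule surj_card_le[rotated])
  also have "\<dots> = card (insert \<one>\<^bsub>G\<^esub> S) ^ k" using S(2) by (intro card_lists_length_eq) simp
  also have "\<dots> \<le> Suc (card S) ^ k" by (intro power_mono card_insert_le_m1) (auto simp: S card_insert_if)
  finally show ?thesis .
qed

lemma directed_circulant_orders_subset: "directed_circulant_orders d k \<subseteq> {..Suc d ^ k}"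
proof
  fix n assume "n \<in> directed_circulant_orders d k"
  then obtain S where S: "n \<ge> 1" "S \<subseteq> carrier (integer_mod_group n)" "card S = d"
    "digraph_diameter (cayley_digraph (integer_mod_group n) S) = ereal (real k)"
    by (auto simp: directed_circulant_orders_def)
  have "finite S" using S(1,2) by (auto simp: carrier_integer_mod_group intro: finite_subset)
  from order_cayley_le[OF group_integer_mod_group S(2) this S(4)] show "n \<in> {..Suc d ^ k}"
    using S(1,3) by (simp add: carrier_integer_mod_group)
qed

lemma undirected_circulant_orders_subset:
  "undirected_circulant_orders d k \<subseteq> directed_circulant_orders d k"
  unfolding undirected_circulant_orders_def directed_circulant_orders_def by blast

lemma finite_directed_circulant_orders: "finite (directed_circulant_orders d k)"
  by (rule finite_subset[OF directed_circulant_orders_subset]) simp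

lemma finite_undirected_circulant_orders: "finite (undirected_circulant_orders d k)"
  by (rule finite_subset[OF undirected_circulant_orders_subset finite_directed_circulant_orders])

lemma DCC_le: "DCC d k \<le> Suc d ^ k"
  using directed_circulant_orders_subset[of d k] finite_directed_circulant_orders[of d k]
  by (auto simp: DCC_def Sup_nat_def)

lemma CC_le: "CC d k \<le> Suc d ^ k"
  using directed_circulant_orders_subset[of d k] undirected_circulant_orders_subset[of d k]
    finite_undirected_circulant_orders[of d k]
  by (auto simp: CC_def Sup_nat_def)

lemma limsup_order_le:
  assumes "\<And>d. f d \<le> Suc d ^ k"
  shows "limsup (\<lambda>d. ereal (real (f d) / real d ^ k)) \<le> ereal (2 ^ k)"
proof (rule Limsup_bounded)
  show "\<forall>\<^sub>F d in sequentially. ereal (real (f d) / real d ^ k) \<le> ereal (2 ^ k)"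
    using eventually_ge_at_top[of "1::nat"]
  proof eventually_elim
    case (elim d)
    have "real (f d) \<le> real (Suc d ^ k)" using assms[of d] by (simp only: of_nat_le_iff)
    also have "\<dots> \<le> (2 * real d) ^ k" unfolding of_nat_power using elim by (intro power_mono) auto
    finally show ?case using elim by (simp add: field_simps)
  qed
qed

lemma liminf_order_ge: "0 \<le> liminf (\<lambda>d. ereal (real (f d) / real d ^ k))"
  by (rule Liminf_bounded) simp

lemma liminf_le_limsup_seq: "liminf (f :: nat \<Rightarrow> ereal) \<le> limsup f"
  by (rule Liminf_le_Limsup) simp

lemma limits_bounds:
  "LC_minus k \<in> {0..ereal (2 ^ k)}" "LC_plus k \<in> {0..ereal (2 ^ k)}"
  "LD_minus k \<in> {0..ereal (2 ^ k)}" "LD_plus k \<in> {0..ereal (2 ^ k)}"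
  unfolding LC_minus_def LC_plus_def LD_minus_def LD_plus_def
  using limsup_order_le[of "\<lambda>d. CC d k" k, OF CC_le] limsup_order_le[of "\<lambda>d. DCC d k" k, OF DCC_le]
  by (auto intro: liminf_order_ge order_trans[OF liminf_order_ge liminf_le_limsup_seq]
      order_trans[OF liminf_le_limsup_seq])

end

theory Submission
  imports Defs "HOL-Number_Theory.Cong" "HOL-Library.Multiset"
begin

text \<open>A tower of subgroups combines circulant graphs of orders \<open>n\<close> and \<open>n'\<close> into one of order
  \<open>n n'\<close>, adding up degrees and diameters; no coprimality is needed. For \<open>K = m k + r\<close> with
  \<open>1 \<le> r \<le> k\<close>, stack \<open>m\<close> copies of a large graph of diameter \<open>k\<close> and degree about \<open>D k / K\<close> and
  \<open>r\<close> complete graphs of degree about \<open>D / K\<close>. As \<open>D\<close> grows, this yields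
  \<open>R(K)\<^sup>K \<ge> R(k)\<^sup>m\<^sup>k\<close>. Keeping \<open>k\<close> fixed and letting \<open>K\<close> grow gives \<open>lim inf R \<ge> R(k)\<close>. Using only
  copies of one graph besides the complete ones makes this work for upper limits too, because no two
  sequences of good degrees have to be matched. Counting multisets of \<open>k\<close> generators gives
  \<open>L(k) \<le> 1 / k!\<close>, so that \<open>R \<le> e\<close>.\<close>

section \<open>Covering all residues by bounded sums\<close>

definition covers :: "nat \<Rightarrow> int set \<Rightarrow> nat \<Rightarrow> bool" where
  "covers n A k \<longleftrightarrow> (\<forall>x. \<exists>xs. set xs \<subseteq> insert 0 A \<and> length xs = k \<and> [sum_list xs = x] (mod int n))"

lemma covers_cong:
  assumes "covers n A k" "\<And>a. a \<in> A \<Longrightarrow> \<exists>b\<in>insert 0 B. [a = b] (mod int n)"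
  shows "covers n B k"
proof -
  obtain g where g: "\<And>a. a \<in> A \<Longrightarrow> g a \<in> insert 0 B \<and> [a = g a] (mod int n)"
    using assms(2) by metis
  define h where "h a = (if a \<in> A then g a else 0)" for a
  have h: "h a \<in> insert 0 B" "[a = h a] (mod int n)" if "a \<in> insert 0 A" for a
    using that g by (auto simp: h_def)
  have *: "[sum_list xs = sum_list (map h xs)] (mod int n)" if "set xs \<subseteq> insert 0 A" for xs
    using that by (induction xs) (auto intro!: cong_add h)
  show ?thesis unfolding covers_def
  proof
    fix x
    obtain xs where xs: "set xs \<subseteq> insert 0 A" "length xs = k" "[sum_list xs = x] (mod int n)"
      using assms(1) by (auto simp: covers_def)
    have "set (map h xs) \<subseteq> insert 0 B" using xs(1) h(1) by auto
    moreover have "[sum_list (map h xs) = x] (mod int n)"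
      using *[OF xs(1)] xs(3) cong_sym cong_trans by blast
    ultimately show "\<exists>xs. set xs \<subseteq> insert 0 B \<and> length xs = k \<and> [sum_list xs = x] (mod int n)"
      using xs(2) by (intro exI[of _ "map h xs"]) auto
  qed
qed

text \<open>One floor of the tower: a sum over \<open>A\<close> reaches \<open>x\<close> modulo
  \<open>n\<close>. The error is a multiple \<open>n * y\<close>, where \<open>y\<close> matters
  only modulo \<open>m\<close>, so \<open>B\<close> scaled by \<open>n\<close> removes it.\<close>

lemma covers_mult:
  assumes "covers n A j" "covers m B k"
  shows "covers (n * m) (A \<union> (*) (int n) ` B) (j + k)"
  unfolding covers_def
proof
  fix x
  obtain xs where xs: "set xs \<subseteq> insert 0 A" "length xs = j" "[x = sum_list xs] (mod int n)"
    using assms(1) by (metis covers_def cong_sym)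
  obtain y where y: "x - sum_list xs = int n * y"
    using xs(3) by (auto simp: cong_iff_dvd_diff elim: dvdE)
  then have x: "sum_list xs + int n * y = x" by simp
  obtain ys where ys: "set ys \<subseteq> insert 0 B" "length ys = k" "[sum_list ys = y] (mod int m)"
    using assms(2) by (auto simp: covers_def)
  let ?zs = "xs @ map ((*) (int n)) ys"
  have "[int n * sum_list ys = int n * y] (mod int n * int m)"
    using ys(3) by (auto simp: cong_iff_dvd_diff simp flip: right_diff_distrib)
  then have "[sum_list xs + int n * sum_list ys = sum_list xs + int n * y] (mod int n * int m)"
    by (intro cong_add) auto
  then have "[sum_list ?zs = x] (mod int (n * m))"
    using x by (simp add: sum_list_const_mult)
  moreover have "set ?zs \<subseteq> insert 0 (A \<union> (*) (int n) ` B)" using xs(1) ys(1) by auto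
  ultimately show "\<exists>zs. set zs \<subseteq> insert 0 (A \<union> (*) (int n) ` B) \<and> length zs = j + k \<and>
      [sum_list zs = x] (mod int (n * m))"
    using xs(2) ys(2) by (intro exI[of _ ?zs]) auto
qed

section \<open>Towers of equal floors and the counting bound\<close>

text \<open>The generators of a tower of \<open>m\<close> copies of one graph: floor
  \<open>i\<close> serves the digit of weight \<open>n ^ i\<close> in base \<open>n\<close>.\<close>

definition digits :: "nat \<Rightarrow> int set \<Rightarrow> nat \<Rightarrow> int set" where
  "digits n A m = (\<Union>i<m. (*) (int n ^ i) ` A)"

lemma digits_Suc: "digits n A (Suc m) = digits n A m \<union> (*) (int (n ^ m)) ` A"
  by (auto simp: digits_def lessThan_Suc)

lemma covers_digits:
  assumes "covers n A k"
  shows "covers (n ^ m) (digits n A m) (m * k)"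
proof (induction m)
  case 0
  show ?case by (auto simp: covers_def)
next
  case (Suc m)
  from covers_mult[OF this assms] show ?case
    by (simp add: digits_Suc algebra_simps)
qed

lemma finite_digits: "finite A \<Longrightarrow> finite (digits n A m)"
  by (simp add: digits_def)

lemma card_digits_le: "finite A \<Longrightarrow> card (digits n A m) \<le> m * card A"
proof (induction m)
  case (Suc m)
  have "card (digits n A (Suc m)) \<le> card (digits n A m) + card ((*) (int (n ^ m)) ` A)"
    unfolding digits_Suc by (rule card_Un_le)
  also have "\<dots> \<le> m * card A + card A"
    using Suc by (intro add_mono card_image_le) auto
  finally show ?case by simp
qed (simp add: digits_def)

lemma digits_symmetric: "digits n (V \<union> uminus ` V) m = digits n V m \<union> uminus ` digits n V m"
  by (auto simp: digits_def image_Un image_UN image_image)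

text \<open>Since \<open>n ^ i * v\<close> is at most half of \<open>n ^ (i + 1)\<close>, a set of
  representatives in the lower half of the residues stays in the lower half on every floor.\<close>

lemma digits_bound:
  assumes "v \<in> digits n V m" "\<And>v. v \<in> V \<Longrightarrow> 0 < v \<and> 2 * v \<le> int n" "n \<ge> 1"
  shows "0 < v \<and> 2 * v \<le> int (n ^ m)"
proof -
  obtain i w where iw: "i < m" "w \<in> V" "v = int n ^ i * w"
    using assms(1) by (auto simp: digits_def)
  have "2 * v \<le> int n ^ i * int n"
    using assms(2)[OF iw(2)] assms(3) iw(3) by (simp add: mult.left_commute)
  also have "\<dots> = int n ^ Suc i" by simp
  also have "\<dots> \<le> int n ^ m" using iw(1) assms(3) by (intro power_increasing) auto
  finally show ?thesis using assms(2)[OF iw(2)] assms(3) iw(3) by simp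
qed

text \<open>Addition commutes, so a sum depends only on the multiset of its terms. Counting
  multisets instead of words is what gains the factor \<open>1 / fact k\<close>.\<close>

lemma covers_order_le:
  assumes "covers n A k" "finite A" "n \<ge> 1"
  shows "n \<le> (card A + k) choose k"
proof -
  let ?M = "multisets_of_size (insert 0 A) k"
  have "{0..<int n} \<subseteq> (\<lambda>M. sum_mset M mod int n) ` ?M"
  proof
    fix x assume x: "x \<in> {0..<int n}"
    obtain xs where xs: "set xs \<subseteq> insert 0 A" "length xs = k" "[sum_list xs = x] (mod int n)"
      using assms(1) by (auto simp: covers_def)
    show "x \<in> (\<lambda>M. sum_mset M mod int n) ` ?M"
      using xs x by (intro image_eqI[of _ _ "mset xs"])
        (auto simp: multisets_of_size_def sum_mset_sum_list cong_def)
  qed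
  then have "card {0..<int n} \<le> card ?M"
    using assms(2) by (intro surj_card_le) (auto intro: finite_multisets_of_size)
  also have "\<dots> = (card (insert 0 A) + k - 1) choose k"
    using assms(2) by (intro card_multisets_of_size) auto
  also have "\<dots> \<le> (card A + k) choose k"
    using assms(2) by (intro binomial_right_mono) (auto simp: card_insert_if)
  finally show ?thesis by simp
qed

section \<open>Covering and the diameter\<close>

lemma foldl_integer_mod_group:
  "[foldl (\<otimes>\<^bsub>integer_mod_group n\<^esub>) u xs = u + sum_list xs] (mod int n)"
proof (induction xs arbitrary: u)
  case (Cons a xs)
  have "[(u + a) mod int n + sum_list xs = (u + a) + sum_list xs] (mod int n)"
    by (intro cong_add) auto
  with Cons[of "(u + a) mod int n"] show ?case
    by (auto simp: add.assoc intro: cong_trans)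
qed auto

text \<open>A walk from \<open>0\<close> spells out a sum of generators. The strict bound by
  \<open>k + 1\<close> serves two uses: diameter equal to \<open>k\<close>, and refuting a diameter
  that is too small.\<close>

lemma covers_if_diameter_less:
  assumes S: "S \<subseteq> carrier (integer_mod_group n)" and n: "n \<ge> 1"
    and diam: "digraph_diameter (cayley_digraph (integer_mod_group n) S) < ereal (real (Suc k))"
  shows "covers n S k"
  unfolding covers_def
proof
  fix x :: int
  let ?G = "integer_mod_group n"
  interpret wf_digraph "with_proj (cayley_digraph ?G S)"
    using S by (intro wf_digraph_cayley) auto
  have v: "x mod int n \<in> carrier ?G" using n by (simp add: carrier_integer_mod_group)
  have "\<mu> (\<lambda>_. 1) 0 (x mod int n) \<le> digraph_diameter (cayley_digraph ?G S)"
    unfolding digraph_diameter_def using v integer_mod_group_0[of n]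
    by (intro SUP_upper2[of 0] SUP_upper) (auto simp: cayley_digraph_def)
  also note diam
  \<comment> \<open>The distance is an infimum over walks, so some walk already costs less than
    \<open>k + 1\<close>; unit weights then bound its length by \<open>k\<close>.\<close>
  finally obtain p where p: "awalk 0 p (x mod int n)" "awalk_cost (\<lambda>_. 1) p < real (Suc k)"
    unfolding \<mu>_def INF_less_iff by auto
  have "awalk_cost (\<lambda>_. 1) p = real (length p)" by (induction p) auto
  with p have "length p \<le> k" by simp
  from awalk_cayley_foldl[OF group_integer_mod_group S p(1) this] obtain xs where
    xs: "set xs \<subseteq> insert 0 S" "length xs = k"
      "x mod int n = foldl (\<otimes>\<^bsub>?G\<^esub>) 0 xs" by auto
  have "[sum_list xs = x] (mod int n)"
    using foldl_integer_mod_group[of n 0 xs] xs(3) by (metis add_0 cong_def mod_mod_trivial)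
  with xs show "\<exists>xs. set xs \<subseteq> insert 0 S \<and> length xs = k \<and> [sum_list xs = x] (mod int n)"
    by blast
qed

text \<open>Converse of \<open>awalk_cayley_foldl\<close>. A neutral term outside \<open>S\<close>
  contributes no arc, hence only an inequality for the length.\<close>

lemma cayley_awalk_exists:
  assumes G: "group G" and S: "S \<subseteq> carrier G" and u: "u \<in> carrier G"
    and xs: "set xs \<subseteq> insert \<one>\<^bsub>G\<^esub> S"
  shows "\<exists>p. pre_digraph.awalk (with_proj (cayley_digraph G S)) u p (foldl (\<otimes>\<^bsub>G\<^esub>) u xs) \<and>
    length p \<le> length xs"
  using u xs
proof (induction xs arbitrary: u)
  case Nil
  interpret wf_digraph "with_proj (cayley_digraph G S)"
    using G S by (rule wf_digraph_cayley)
  have "u \<in> verts (with_proj (cayley_digraph G S))" using Nil by (simp add: cayley_digraph_def)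
  then show ?case by (intro exI[of _ "[]"]) (auto simp: awalk_Nil_iff)
next
  case (Cons s xs)
  interpret G: group G by (rule G)
  interpret wf_digraph "with_proj (cayley_digraph G S)"
    using G S by (rule wf_digraph_cayley)
  have "u \<otimes>\<^bsub>G\<^esub> s \<in> carrier G" using Cons.prems S by auto
  from Cons.IH[OF this] Cons.prems(2) obtain p where
    p: "awalk (u \<otimes>\<^bsub>G\<^esub> s) p (foldl (\<otimes>\<^bsub>G\<^esub>) u (s # xs))" "length p \<le> length xs" by auto
  show ?case
  proof (cases "s \<in> S")
    case True
    then have "(u, u \<otimes>\<^bsub>G\<^esub> s) \<in> parcs (cayley_digraph G S)"
      using Cons.prems(1) by (auto simp: cayley_digraph_def)
    then show ?thesis using p
      by (intro exI[of _ "(u, u \<otimes>\<^bsub>G\<^esub> s) # p"]) (auto simp: awalk_Cons_iff)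
  next
    case False
    then show ?thesis using p Cons.prems by (intro exI[of _ p]) auto
  qed
qed

lemma diameter_le_if_covers:
  assumes S: "S \<subseteq> carrier (integer_mod_group n)" and n: "n \<ge> 1" and "covers n S k"
  shows "digraph_diameter (cayley_digraph (integer_mod_group n) S) \<le> ereal (real k)"
  unfolding digraph_diameter_def
proof (intro SUP_least)
  let ?G = "integer_mod_group n"
  interpret wf_digraph "with_proj (cayley_digraph ?G S)"
    using S by (intro wf_digraph_cayley) auto
  fix u v assume "u \<in> verts (with_proj (cayley_digraph ?G S))" "v \<in> verts (with_proj (cayley_digraph ?G S))"
  then have uv: "u \<in> carrier ?G" "v \<in> carrier ?G" by (auto simp: cayley_digraph_def)
  \<comment> \<open>By translation it suffices to write the difference \<open>v - u\<close> as a
    sum.\<close>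
  obtain xs where xs: "set xs \<subseteq> insert 0 S" "length xs = k" "[sum_list xs = v - u] (mod int n)"
    using assms(3) by (auto simp: covers_def)
  let ?w = "foldl (\<otimes>\<^bsub>?G\<^esub>) u xs"
  obtain p where p: "awalk u p ?w" "length p \<le> k"
    using cayley_awalk_exists[OF group_integer_mod_group S uv(1)] xs by auto
  have "[u + sum_list xs = u + (v - u)] (mod int n)" using xs(3) by (intro cong_add) auto
  then have "[?w = v] (mod int n)" using foldl_integer_mod_group[of n u xs] cong_trans by force
  moreover have "?w \<in> carrier ?G" using awalk_last_in_verts[OF p(1)] by (simp add: cayley_digraph_def)
  ultimately have "?w = v" using uv(2) n
    by (auto simp: carrier_integer_mod_group intro: cong_less_imp_eq_int)
  have "awalk_cost (\<lambda>_. 1) p = real (length p)" by (induction p) auto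
  then show "\<mu> (\<lambda>_. 1) u v \<le> ereal (real k)"
    using min_cost_le_walk_cost[of u p v "\<lambda>_. 1"] p \<open>?w = v\<close>
    by (auto intro: order_trans)
qed

text \<open>A circulant graph of small diameter has few vertices, so the diameter is exactly
  \<open>k\<close> as soon as the order exceeds the bound for \<open>k - 1\<close>.\<close>

lemma diameter_eq_if_covers:
  assumes S: "S \<subseteq> carrier (integer_mod_group n)" and "covers n S k"
    and big: "(card S + 1) ^ (k - 1) < n" and k: "k \<ge> 1"
  shows "digraph_diameter (cayley_digraph (integer_mod_group n) S) = ereal (real k)"
proof (rule antisym)
  have n: "n \<ge> 1" using big by simp
  then show "digraph_diameter (cayley_digraph (integer_mod_group n) S) \<le> ereal (real k)"
    using assms by (intro diameter_le_if_covers)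
  have fin: "finite S" using S n by (auto simp: carrier_integer_mod_group intro: finite_subset)
  show "ereal (real k) \<le> digraph_diameter (cayley_digraph (integer_mod_group n) S)"
  proof (rule ccontr)
    assume "\<not> ?thesis"
    \<comment> \<open>A diameter below \<open>k = Suc (k - 1)\<close> makes words of length
      \<open>k - 1\<close> suffice, and there are too few of them for \<open>n\<close>
      residues.\<close>
    then have "covers n S (k - 1)" using S n k by (intro covers_if_diameter_less) auto
    then have "\<exists>xs. (set xs \<subseteq> insert 0 S \<and> length xs = k - 1) \<and> x = sum_list xs mod int n"
      if "x \<in> {0..<int n}" for x
      using that unfolding covers_def cong_def by (metis atLeastLessThan_iff mod_pos_pos_trivial)
    then have "{0..<int n} \<subseteq> (\<lambda>xs. sum_list xs mod int n) ` {xs. set xs \<subseteq> insert 0 S \<and> length xs = k - 1}"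
      by (auto simp: image_iff)
    then have "card {0..<int n} \<le> card {xs. set xs \<subseteq> insert 0 S \<and> length xs = k - 1}"
      using fin by (intro surj_card_le finite_lists_length_eq) auto
    also have "\<dots> = card (insert 0 S) ^ (k - 1)" using fin by (intro card_lists_length_eq) simp
    also have "\<dots> \<le> (card S + 1) ^ (k - 1)"
      using fin by (intro power_mono) (auto simp: card_insert_if)
    finally show False using big by simp
  qed
qed

section \<open>Circulant graphs of prescribed degree and diameter\<close>

text \<open>Reduce \<open>A\<close> modulo \<open>N\<close>, remove \<open>0\<close> and pad to
  exactly \<open>D\<close> generators; extra generators preserve covering. The hypothesis
  \<open>big\<close> leaves room for the padding and forces the diameter up to
  \<open>K\<close>.\<close>

lemma directed_circulant_orders_intro:
  assumes cov: "covers N A K" and A: "finite A" "card A \<le> D"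
    and big: "(D + 1) ^ (K - 1) < N" and K: "K \<ge> 2"
  shows "N \<in> directed_circulant_orders D K"
proof -
  have "(D + 1) ^ 1 \<le> (D + 1) ^ (K - 1)" using K by (intro power_increasing) auto
  then have D: "D < N" using big by simp
  let ?B = "(\<lambda>a. a mod int N) ` A - {0}"
  have "card ?B \<le> D"
    using A card_image_le[OF A(1), of "\<lambda>a. a mod int N"] card_Diff1_le[of "(\<lambda>a. a mod int N) ` A" 0]
    by linarith
  moreover have "D \<le> card {1..<int N}" using D by simp
  moreover have "?B \<subseteq> {1..<int N}"
  proof
    fix x assume "x \<in> ?B"
    then obtain a where a: "x = a mod int N" "x \<noteq> 0" by auto
    have "0 \<le> x" "x < int N" using D unfolding a(1) by auto
    with a(2) show "x \<in> {1..<int N}" by auto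
  qed
  ultimately obtain T where T: "?B \<subseteq> T" "T \<subseteq> {1..<int N}" "card T = D"
    using exists_subset_between[of ?B D "{1..<int N}"] by auto
  have "covers N T K" using cov
  proof (rule covers_cong)
    fix a assume "a \<in> A"
    then show "\<exists>b\<in>insert 0 T. [a = b] (mod int N)"
      using T(1) by (intro bexI[of _ "a mod int N"]) auto
  qed
  moreover have TS: "T \<subseteq> carrier (integer_mod_group N) - {0}"
    using T(2) D by (auto simp: carrier_integer_mod_group)
  ultimately have "digraph_diameter (cayley_digraph (integer_mod_group N) T) = ereal (real K)"
    using big K T(3) by (intro diameter_eq_if_covers) auto
  then show ?thesis using TS T(3) D unfolding directed_circulant_orders_def by auto
qed

text \<open>In an undirected circulant graph of order \<open>N\<close> the degree is odd iff \<open>N/2\<close>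
  is a generator; hence the parity conditions.\<close>

lemma undirected_circulant_orders_intro:
  assumes cov: "covers N (V \<union> uminus ` V) K" and V: "finite V" "2 * card V \<le> D"
    and Vpos: "\<And>v. v \<in> V \<Longrightarrow> 0 < v \<and> 2 * v \<le> int N"
    and ev: "\<And>v. even D \<Longrightarrow> v \<in> V \<Longrightarrow> 2 * v < int N" and od: "odd D \<Longrightarrow> even N"
    and big: "(D + 1) ^ (K - 1) < N" and K: "K \<ge> 2"
  shows "N \<in> undirected_circulant_orders D K"
proof -
  have "(D + 1) ^ 1 \<le> (D + 1) ^ (K - 1)" using K by (intro power_increasing) auto
  then have D: "D < N" using big by simp
  \<comment> \<open>One representative from each pair of distinct opposite residues. Padding takes
    place inside \<open>?C\<close> and is then mirrored, so it preserves symmetry.\<close>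
  let ?C = "{1..(int N - 1) div 2}"
  have C: "x \<in> ?C \<longleftrightarrow> 0 < x \<and> 2 * x < int N" for x by auto
  let ?V' = "V \<inter> ?C"
  have "card ?V' \<le> card V" using V(1) by (intro card_mono) auto
  then have "card ?V' \<le> D div 2" using V(2) by linarith
  moreover have "D div 2 \<le> card ?C" using D by simp
  ultimately obtain U where U: "?V' \<subseteq> U" "U \<subseteq> ?C" "card U = D div 2"
    using exists_subset_between[of ?V' "D div 2" ?C] by auto
  have U': "0 < u" "2 * u < int N" if "u \<in> U" for u using that U(2) C by auto
  have finU: "finite U" using U(2) finite_subset by blast
  \<comment> \<open>The self-inverse residue \<open>N / 2\<close> adjusts the parity of the
    degree.\<close>
  define H where "H = (if odd D then {int N div 2} else {})"
  have H: "2 * x = int N" "odd D" if "x \<in> H" for x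
    using that od by (auto simp: H_def split: if_splits)
  define T where "T = U \<union> (\<lambda>u. int N - u) ` U \<union> H"
  have disj: "U \<inter> (\<lambda>u. int N - u) ` U = {}" "(U \<union> (\<lambda>u. int N - u) ` U) \<inter> H = {}"
  proof -
    have "x \<noteq> int N - u" if "x \<in> U" "u \<in> U" for x u
      using U'(2)[OF that(1)] U'(2)[OF that(2)] by linarith
    then show "U \<inter> (\<lambda>u. int N - u) ` U = {}" by blast
    have "x \<noteq> u" "x \<noteq> int N - u" if "u \<in> U" "x \<in> H" for x u
      using U'(2)[OF that(1)] H(1)[OF that(2)] by linarith+
    then show "(U \<union> (\<lambda>u. int N - u) ` U) \<inter> H = {}" by blast
  qed
  have "card T = card (U \<union> (\<lambda>u. int N - u) ` U) + card H"
    unfolding T_def using finU disj(2) by (intro card_Un_disjoint) (auto simp: H_def)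
  also have "card (U \<union> (\<lambda>u. int N - u) ` U) = card U + card ((\<lambda>u. int N - u) ` U)"
    using finU disj(1) by (intro card_Un_disjoint) auto
  also have "card ((\<lambda>u. int N - u) ` U) = card U" by (intro card_image) (auto simp: inj_on_def)
  also have "card U + card U + card H = D" by (auto simp: U(3) H_def) presburger+
  finally have cardT: "card T = D" .
  have Trange: "0 < x \<and> x < int N" if "x \<in> T" for x
    using that unfolding T_def
  proof (elim UnE imageE)
    assume "x \<in> U"
    then show ?thesis using U'[of x] by linarith
  next
    fix u assume "x = int N - u" "u \<in> U"
    then show ?thesis using U'[of u] by linarith
  next
    assume "x \<in> H"
    then show ?thesis using H(1)[of x] D by linarith
  qed
  have TS: "T \<subseteq> carrier (integer_mod_group N) - {0}"
    using Trange D by (force simp: carrier_integer_mod_group)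
  have "m_inv (integer_mod_group N) x = int N - x" if "x \<in> T" for x
  proof -
    have "x \<in> carrier (integer_mod_group N)" using that TS by auto
    moreover have "(- x) mod int N = int N - x"
      using Trange[OF that] by (simp add: zmod_zminus1_eq_if)
    ultimately show ?thesis by simp
  qed
  then have "m_inv (integer_mod_group N) ` T = (\<lambda>x. int N - x) ` T" by (intro image_cong) auto
  also have "\<dots> = T"
  \<comment> \<open>The reflection swaps \<open>U\<close> with its mirror image and fixes the only
    possible element of \<open>H\<close>.\<close>
  proof -
    have "int N - x = x" if "x \<in> H" for x using H(1)[OF that] by simp
    then have "(\<lambda>x. int N - x) ` H = H" by simp
    then show ?thesis unfolding T_def by (simp add: image_Un image_image Un_commute)
  qed
  finally have sym: "T = m_inv (integer_mod_group N) ` T" ..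
  have "covers N T K" using cov
  proof (rule covers_cong)
    fix a assume "a \<in> V \<union> uminus ` V"
    then obtain v where v: "v \<in> V" "a = v \<or> a = - v" by auto
    have neg: "[- v = int N - v] (mod int N)" by (simp add: cong_iff_dvd_diff)
    show "\<exists>b\<in>insert 0 T. [a = b] (mod int N)"
    proof (cases "2 * v < int N")
      case True
      then have "v \<in> T" "int N - v \<in> T" using v(1) Vpos U(1) C by (auto simp: T_def)
      then show ?thesis using v(2) neg by (metis cong_refl insertI2)
    next
      case False
      \<comment> \<open>Only \<open>v = N / 2\<close> remains; \<open>ev\<close> excludes it for
        even \<open>D\<close>, and for odd \<open>D\<close> it lies in \<open>H\<close>.\<close>
      then have "2 * v = int N" "odd D" using v(1) Vpos ev by force+
      then have "v \<in> T" "int N - v = v" by (auto simp: T_def H_def)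
      then show ?thesis using v(2) neg by (metis cong_refl insertI2)
    qed
  qed
  then have "digraph_diameter (cayley_digraph (integer_mod_group N) T) = ereal (real K)"
    using big K cardT TS by (intro diameter_eq_if_covers) auto
  moreover have "N \<ge> 1" using D by simp
  ultimately show ?thesis
    unfolding undirected_circulant_orders_def mem_Collect_eq using TS cardT sym by metis
qed

section \<open>Stacking circulant graphs and complete graphs\<close>

text \<open>A complete graph in symmetric form: the integers from \<open>-h\<close> to
  \<open>h\<close> are at least \<open>n\<close> consecutive ones.\<close>

lemma covers_interval: "n \<le> 2 * h + 1 \<Longrightarrow> n \<ge> 1 \<Longrightarrow> covers n ({1..int h} \<union> uminus ` {1..int h}) 1"
  unfolding covers_def
proof
  fix x :: int assume n: "n \<le> 2 * h + 1" "n \<ge> 1"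
  define y where "y = (x + int h) mod int n - int h"
  have "0 \<le> (x + int h) mod int n" "(x + int h) mod int n < int n" using n(2) by auto
  then have "- int h \<le> y" "y \<le> int h" using n(1) unfolding y_def by linarith+
  then have "y \<in> insert 0 ({1..int h} \<union> uminus ` {1..int h})"
    by (cases "y \<ge> 0") (auto intro: image_eqI[of _ _ "- y"])
  moreover have "[y = x] (mod int n)"
    by (simp add: y_def cong_def mod_diff_left_eq)
  ultimately show "\<exists>xs. set xs \<subseteq> insert 0 ({1..int h} \<union> uminus ` {1..int h}) \<and>
      length xs = 1 \<and> [sum_list xs = x] (mod int n)"
    by (intro exI[of _ "[y]"]) auto
qed

lemma covers_if_circulant_order:
  assumes "S \<subseteq> carrier (integer_mod_group n)" "n \<ge> 1"
    and "digraph_diameter (cayley_digraph (integer_mod_group n) S) = ereal (real k)"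
  shows "covers n S k" "finite S"
  using assms covers_if_diameter_less[of S n k]
  by (auto simp: carrier_integer_mod_group intro: finite_subset)

text \<open>The tower has \<open>m\<close> floors from the given graph and above them
  \<open>r\<close> floors from the complete graph on \<open>q\<close> residues, each of diameter at
  most \<open>1\<close>.\<close>

lemma directed_circulant_orders_product:
  assumes n: "n \<in> directed_circulant_orders d k" and kmr: "k \<ge> 1" "m \<ge> 1" "r \<ge> 1"
    and deg: "m * d + r * q \<le> D" and big: "(D + 1) ^ (m * k + r - 1) < n ^ m * q ^ r"
  shows "n ^ m * q ^ r \<in> directed_circulant_orders D (m * k + r)"
proof -
  obtain S where S: "n \<ge> 1" "S \<subseteq> carrier (integer_mod_group n)" "card S = d"
    "digraph_diameter (cayley_digraph (integer_mod_group n) S) = ereal (real k)"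
    using n by (auto simp: directed_circulant_orders_def)
  note cS = covers_if_circulant_order[OF S(2,1,4)]
  have q: "q \<ge> 1" using big kmr(3) by (cases q) (auto simp: power_0_left)
  have cq: "covers q {1..int q} 1" unfolding covers_def
  proof
    fix x :: int
    show "\<exists>xs. set xs \<subseteq> insert 0 {1..int q} \<and> length xs = 1 \<and> [sum_list xs = x] (mod int q)"
    proof (intro exI[of _ "[x mod int q]"] conjI)
      have "y \<in> insert 0 {1..int q}" if "0 \<le> y" "y < int q" for y using that by auto
      then have "x mod int q \<in> insert 0 {1..int q}" using q by (meson of_nat_0_less_iff
        less_le_trans less_one pos_mod_bound pos_mod_sign zero_less_one)
      then show "set [x mod int q] \<subseteq> insert 0 {1..int q}" by simp
    qed auto
  qed
  let ?A = "digits n S m \<union> (*) (int (n ^ m)) ` digits q {1..int q} r"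
  have cov: "covers (n ^ m * q ^ r) ?A (m * k + r)"
    using covers_mult[OF covers_digits[OF cS(1)] covers_digits[OF cq]] by simp
  have "card ?A \<le> card (digits n S m) + card (digits q {1..int q} r)"
    by (intro order_trans[OF card_Un_le] add_mono card_image_le finite_digits) auto
  also have "\<dots> \<le> m * d + r * q"
    using card_digits_le[of S n m] card_digits_le[of "{1..int q}" q r] cS(2) S(3)
    by (intro add_mono) auto
  finally have "card ?A \<le> D" using deg by simp
  moreover have "m * k + r \<ge> 2" using mult_le_mono[of 1 m 1 k] kmr by linarith
  ultimately show ?thesis
    using cov cS(2) big by (intro directed_circulant_orders_intro) (auto intro: finite_digits)
qed

text \<open>Reflection injects the strict lower half into the upper half. Only \<open>n / 2\<close>
  can have no partner, which accounts for the extra \<open>1\<close>.\<close>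

lemma symmetric_half:
  assumes S: "S \<subseteq> {0<..<int n}" "\<And>x. x \<in> S \<Longrightarrow> int n - x \<in> S"
  shows "2 * card {x \<in> S. 2 * x \<le> int n} \<le> card S + 1"
proof -
  let ?V = "{x \<in> S. 2 * x \<le> int n}" and ?W = "{x \<in> S. 2 * x < int n}"
  have fin: "finite S" using S(1) finite_subset by blast
  have "card ?V \<le> card (insert (int n div 2) ?W)" using fin by (intro card_mono) auto
  also have "\<dots> \<le> card ?W + 1" using fin by (auto simp: card_insert_if)
  also have "card ?W \<le> card {x \<in> S. int n < 2 * x}"
    using fin S(2) by (intro card_inj_on_le[of "\<lambda>x. int n - x"]) (auto simp: inj_on_def)
  finally have "card ?V \<le> card {x \<in> S. int n < 2 * x} + 1" by simp
  moreover have "card S = card ?V + card {x \<in> S. int n < 2 * x}"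
    using fin by (subst card_Un_disjoint[symmetric]) (auto intro: arg_cong[where f = card])
  ultimately show ?thesis by simp
qed

text \<open>The directed tower is repeated with positive halves of the symmetric sets, mirrored at
  the end. The parity adjustment may enlarge the complete graphs, so the order is only bounded
  below.\<close>

lemma undirected_circulant_orders_product:
  assumes n: "n \<in> undirected_circulant_orders d k" and kmr: "k \<ge> 1" "m \<ge> 1" "r \<ge> 1"
    and deg: "m * (d + 1) + r * (q + 1) \<le> D" and big: "(D + 1) ^ (m * k + r - 1) < n ^ m * q ^ r"
  shows "\<exists>N \<ge> n ^ m * q ^ r. N \<in> undirected_circulant_orders D (m * k + r)"
proof -
  obtain S where S: "n \<ge> 1" "S \<subseteq> carrier (integer_mod_group n) - {0}"
    "S = m_inv (integer_mod_group n) ` S" "card S = d"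
    "digraph_diameter (cayley_digraph (integer_mod_group n) S) = ereal (real k)"
    using n by (auto simp: undirected_circulant_orders_def)
  have Sr: "S \<subseteq> {0<..<int n}" using S(1,2) by (fastforce simp: carrier_integer_mod_group)
  have cS: "covers n S k" "finite S" using covers_if_circulant_order[of S n k] S by auto
  have Sneg: "int n - x \<in> S" if "x \<in> S" for x
  proof -
    have "m_inv (integer_mod_group n) x \<in> S" using that S(3) by blast
    moreover have "x \<in> carrier (integer_mod_group n)" using that S(2) by auto
    ultimately show ?thesis using Sr that by (force simp: zmod_zminus1_eq_if)
  qed
  define V where "V = {x \<in> S. 2 * x \<le> int n}"
  have V: "finite V" "2 * card V \<le> d + 1" "\<And>v. v \<in> V \<Longrightarrow> 0 < v \<and> 2 * v \<le> int n"
    using symmetric_half[OF Sr Sneg] S(4) cS(2) Sr by (auto simp: V_def)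
  have cV: "covers n (V \<union> uminus ` V) k" using cS(1)
  proof (rule covers_cong)
    fix a assume a: "a \<in> S"
    show "\<exists>b\<in>insert 0 (V \<union> uminus ` V). [a = b] (mod int n)"
    proof (cases "2 * a \<le> int n")
      case True
      then show ?thesis using a by (intro bexI[of _ a]) (auto simp: V_def)
    next
      case False
      \<comment> \<open>A generator in the upper half is congruent to the negative of its mirror
        image, which lies in \<open>V\<close>.\<close>
      then have "- (int n - a) \<in> uminus ` V" using Sneg[OF a] by (intro imageI) (auto simp: V_def)
      then show ?thesis by (intro bexI[of _ "- (int n - a)"]) (auto simp: cong_iff_dvd_diff)
    qed
  qed
  have q: "q \<ge> 1" using big kmr(3) by (cases q) (auto simp: power_0_left)
  \<comment> \<open>The order \<open>p\<close> of the complete graphs has parity opposite to \<open>D\<close>, so \<open>N/2\<close> is a generator only if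
    \<open>D\<close> is odd, and \<open>N\<close> is even in that case.\<close>
  define h where "h = (q + 1) div 2"
  define p where "p = 2 * h + (if even D then 1 else 0)"
  have hp: "h \<ge> 1" "2 * h \<le> q + 1" "q \<le> p" "p \<ge> 2" "2 * h \<le> p" "p \<le> 2 * h + 1"
    using q by (auto simp: h_def p_def)
  let ?I = "{1..int h}"
  define N where "N = n ^ m * p ^ r"
  define A where "A = digits n V m" define B where "B = digits p ?I r"
  define W where "W = A \<union> (*) (int (n ^ m)) ` B"
  have A: "0 < v \<and> 2 * v \<le> int (n ^ m)" if "v \<in> A" for v
    using digits_bound[of v n V m] that V(3) S(1) by (auto simp: A_def)
  have B: "0 < v \<and> 2 * v \<le> int (p ^ r)" if "v \<in> B" for v
    using digits_bound[of v p ?I r] that hp by (auto simp: B_def)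
  have nm: "1 \<le> int (n ^ m)" using S(1) by (simp add: one_le_power)
  have pr: "2 \<le> int (p ^ r)"
    using power_increasing[of 1 r p] hp(4) kmr(3) by (simp flip: of_nat_power)
  have W: "0 < v \<and> 2 * v \<le> int N \<and> (even D \<longrightarrow> 2 * v < int N)" if "v \<in> W" for v
    using that unfolding W_def
  proof
    assume v: "v \<in> A"
    \<comment> \<open>The factor \<open>p ^ r \<ge> 2\<close> keeps the lower floors strictly below
      \<open>N / 2\<close>, whatever the parity of \<open>D\<close>.\<close>
    have "int (n ^ m) * 2 \<le> int N" unfolding N_def of_nat_mult using nm pr by (intro mult_left_mono) auto
    then show ?thesis using A[OF v] nm by linarith
  next
    assume "v \<in> (*) (int (n ^ m)) ` B"
    then obtain b where b: "b \<in> B" "v = int (n ^ m) * b" by auto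
    \<comment> \<open>For even \<open>D\<close> the number \<open>p\<close> is odd, so
      \<open>2 * b\<close> cannot equal \<open>p ^ r\<close>.\<close>
    have "2 * b < int (p ^ r)" if "even D"
    proof -
      have "odd (int (p ^ r))" using that by (simp add: p_def)
      then show ?thesis using B[OF b(1)] by (metis dvd_triv_left order_le_less)
    qed
    moreover have "2 * v = int (n ^ m) * (2 * b)" "int N = int (n ^ m) * int (p ^ r)"
      by (simp_all add: b(2) N_def)
    moreover have "0 < int (n ^ m)" using nm by linarith
    ultimately show ?thesis using B[OF b(1)] b(2)
      by (metis mult_le_cancel_left_pos mult_less_cancel_left_pos mult_pos_pos)
  qed
  have cov: "covers N (W \<union> uminus ` W) (m * k + r)"
  proof -
    have "covers p (?I \<union> uminus ` ?I) 1" using hp by (intro covers_interval) auto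
    from covers_mult[OF covers_digits[OF cV] covers_digits[OF this], of m r]
    have "covers N (A \<union> uminus ` A \<union> (*) (int (n ^ m)) ` (B \<union> uminus ` B)) (m * k + r)"
      by (simp only: digits_symmetric A_def B_def N_def mult_1_right)
    also have "A \<union> uminus ` A \<union> (*) (int (n ^ m)) ` (B \<union> uminus ` B) = W \<union> uminus ` W"
      by (auto simp: W_def image_Un image_image)
    finally show ?thesis .
  qed
  have fin: "finite A" "finite B" using V(1) by (auto simp: A_def B_def intro: finite_digits)
  have "card W \<le> card A + card B"
    unfolding W_def by (intro order_trans[OF card_Un_le] add_mono card_image_le fin) auto
  also have "\<dots> \<le> m * card V + r * h"
    using card_digits_le[of V n m] card_digits_le[of ?I p r] V(1)
    by (intro add_mono) (auto simp: A_def B_def)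
  finally have "2 * card W \<le> m * (2 * card V) + r * (2 * h)" by simp
  \<comment> \<open>The summands \<open>1\<close> in \<open>deg\<close> pay for a possible
    \<open>n / 2\<close> in \<open>S\<close> on each lower floor and for the rounding of
    \<open>h\<close> on each upper one.\<close>
  also have "\<dots> \<le> m * (d + 1) + r * (q + 1)" using V(2) hp(2) by (intro add_mono mult_left_mono) auto
  finally have cardW: "2 * card W \<le> D" using deg by simp
  have le: "n ^ m * q ^ r \<le> N" unfolding N_def using hp(3) by (intro mult_left_mono power_mono) auto
  have od: "even N" if "odd D" using that kmr(3) by (simp add: N_def p_def)
  have K: "m * k + r \<ge> 2" using mult_le_mono[of 1 m 1 k] kmr by linarith
  have "N \<in> undirected_circulant_orders D (m * k + r)"
    using cov fin cardW W od K big le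
    by (intro undirected_circulant_orders_intro[of N W]) (auto simp: W_def)
  with le show ?thesis by blast
qed

section \<open>Consequences for the maximal orders\<close>

lemma DCC_product:
  assumes kmr: "k \<ge> 1" "m \<ge> 1" "r \<ge> 1"
    and deg: "m * (d + 1) + r * (q + 1) \<le> D"
    and big: "(D + 1) ^ (m * k + r - 1) < DCC d k ^ m * q ^ r"
  shows "DCC d k ^ m * q ^ r \<le> DCC D (m * k + r)"
proof -
  \<comment> \<open>Without any such graph \<open>DCC d k\<close> would be \<open>0\<close>, and
    \<open>m \<ge> 1\<close> would make the right-hand side of \<open>big\<close> vanish. Hence the
    maximum is attained.\<close>
  have "directed_circulant_orders d k \<noteq> {}" using big kmr(2) by (auto simp: DCC_def Sup_nat_def power_0_left)
  then have "DCC d k \<in> directed_circulant_orders d k"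
    using Max_in[OF finite_directed_circulant_orders] by (simp add: DCC_def Sup_nat_def)
  from directed_circulant_orders_product[OF this kmr _ big]
  have "DCC d k ^ m * q ^ r \<in> directed_circulant_orders D (m * k + r)" using deg by simp
  then show ?thesis unfolding DCC_def[of D]
    by (intro cSup_upper bdd_above_finite finite_directed_circulant_orders)
qed

lemma CC_product:
  assumes kmr: "k \<ge> 1" "m \<ge> 1" "r \<ge> 1"
    and deg: "m * (d + 1) + r * (q + 1) \<le> D"
    and big: "(D + 1) ^ (m * k + r - 1) < CC d k ^ m * q ^ r"
  shows "CC d k ^ m * q ^ r \<le> CC D (m * k + r)"
proof -
  have "undirected_circulant_orders d k \<noteq> {}" using big kmr(2) by (auto simp: CC_def Sup_nat_def power_0_left)
  then have "CC d k \<in> undirected_circulant_orders d k"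
    using Max_in[OF finite_undirected_circulant_orders] by (simp add: CC_def Sup_nat_def)
  from undirected_circulant_orders_product[OF this kmr deg big]
  obtain N where "CC d k ^ m * q ^ r \<le> N" "N \<in> undirected_circulant_orders D (m * k + r)" by blast
  then show ?thesis unfolding CC_def[of D]
    by (intro cSup_upper2 bdd_above_finite finite_undirected_circulant_orders)
qed

lemma DCC_le_binomial: "DCC d k \<le> (d + k) choose k"
proof -
  have "n \<le> (d + k) choose k" if n: "n \<in> directed_circulant_orders d k" for n
  proof -
    obtain S where S: "n \<ge> 1" "S \<subseteq> carrier (integer_mod_group n)" "card S = d"
      "digraph_diameter (cayley_digraph (integer_mod_group n) S) = ereal (real k)"
      using n by (auto simp: directed_circulant_orders_def)
    show ?thesis
      using covers_order_le[OF covers_if_circulant_order[OF S(2,1,4)] S(1)] S(3) by simp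
  qed
  then show ?thesis using finite_directed_circulant_orders[of d k]
    by (auto simp: DCC_def Sup_nat_def)
qed

lemma CC_le_binomial: "CC d k \<le> (d + k) choose k"
proof -
  have "CC d k \<le> DCC d k"
    using finite_directed_circulant_orders[of d k] undirected_circulant_orders_subset[of d k]
    by (cases "undirected_circulant_orders d k = {}") (auto simp: CC_def DCC_def Sup_nat_def intro: Max_mono)
  with DCC_le_binomial show ?thesis using order_trans by blast
qed

section \<open>Asymptotics\<close>

lemma bounded_div_tendsto_0:
  fixes b D :: "nat \<Rightarrow> nat"
  assumes "\<And>i. b i \<le> B" "filterlim D at_top sequentially"
  shows "(\<lambda>i. real (b i) / real (D i)) \<longlonglongrightarrow> 0"
proof (rule tendsto_sandwich[of "\<lambda>_. 0"])
  show "(\<lambda>i. real B / real (D i)) \<longlonglongrightarrow> 0"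
    using assms(2) by (intro tendsto_divide_0[OF tendsto_const]
      filterlim_at_top_imp_at_infinity filterlim_compose[OF filterlim_real_sequentially])
  show "\<forall>\<^sub>F i in sequentially. real (b i) / real (D i) \<le> real B / real (D i)"
    using assms(1) by (intro always_eventually allI divide_right_mono) auto
qed auto

lemma div_div_tendsto:
  fixes d D :: "nat \<Rightarrow> nat"
  assumes lim: "(\<lambda>i. real (d i) / real (D i)) \<longlonglongrightarrow> a" and D: "filterlim D at_top sequentially"
    and k: "k \<ge> 1"
  shows "(\<lambda>i. real (d i div k) / real (D i)) \<longlonglongrightarrow> a / real k"
proof -
  have "(\<lambda>i. real (d i mod k) / real (D i)) \<longlonglongrightarrow> 0"
    using k by (intro bounded_div_tendsto_0[of _ k] D) (simp add: less_imp_le)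
  from tendsto_divide[OF tendsto_diff[OF lim this] tendsto_const[of "real k"]]
  have "(\<lambda>i. (real (d i) / real (D i) - real (d i mod k) / real (D i)) / real k) \<longlonglongrightarrow> a / real k"
    using k by simp
  moreover have "(real (d i) / real (D i) - real (d i mod k) / real (D i)) / real k = real (d i div k) / real (D i)" for i
  proof -
    have "real (d i) = real k * real (d i div k) + real (d i mod k)"
      by (simp flip: of_nat_mult of_nat_add)
    then show ?thesis using k by (simp add: field_simps add_divide_distrib)
  qed
  ultimately show ?thesis by simp
qed

text \<open>The order needed to certify diameter \<open>K\<close> grows one power slower than
  \<open>n ^ K\<close>, so any positive density exceeds it eventually.\<close>

lemma power_Suc_div_power_tendsto_0:
  assumes "K \<ge> 1"
  shows "(\<lambda>n. real ((n + 1) ^ (K - 1)) / real n ^ K) \<longlonglongrightarrow> 0"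
proof -
  have "(\<lambda>n. (1 + inverse (real n)) ^ (K - 1) * inverse (real n)) \<longlonglongrightarrow> (1 + 0) ^ (K - 1) * 0"
    by (intro tendsto_intros lim_inverse_n)
  moreover have "\<forall>\<^sub>F n in sequentially. (1 + inverse (real n)) ^ (K - 1) * inverse (real n) =
      real ((n + 1) ^ (K - 1)) / real n ^ K"
    using eventually_gt_at_top[of 0]
  proof eventually_elim
    case (elim n)
    obtain j where K: "K = Suc j" using assms by (cases K) auto
    have "1 + inverse (real n) = real (n + 1) / real n" using elim by (simp add: field_simps)
    then show ?case using elim by (simp add: K power_divide divide_simps add.commute)
  qed
  ultimately have "(\<lambda>n. real ((n + 1) ^ (K - 1)) / real n ^ K) \<longlonglongrightarrow> (1 + 0) ^ (K - 1) * 0"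
    by (rule Lim_transform_eventually)
  then show ?thesis by simp
qed

section \<open>Transfer of densities from diameter k to diameter K\<close>

text \<open>The asymptotics rest on the tower inequality and the counting bound alone, so one
  argument serves \<open>CC\<close> and \<open>DCC\<close>.\<close>

locale order_function =
  fixes f :: "nat \<Rightarrow> nat \<Rightarrow> nat"
  assumes product: "\<And>k m r d q D. k \<ge> 1 \<Longrightarrow> m \<ge> 1 \<Longrightarrow> r \<ge> 1 \<Longrightarrow> m * (d + 1) + r * (q + 1) \<le> D \<Longrightarrow>
      (D + 1) ^ (m * k + r - 1) < f d k ^ m * q ^ r \<Longrightarrow> f d k ^ m * q ^ r \<le> f D (m * k + r)"
    and le_binomial: "\<And>d k. f d k \<le> (d + k) choose k"
begin

definition density :: "nat \<Rightarrow> nat \<Rightarrow> real" where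
  "density k d = real (f d k) / real d ^ k"

text \<open>The degree is spread evenly over the diameter: \<open>d\<close> gets the share
  \<open>k / K\<close> of \<open>D\<close>, and each complete graph gets \<open>q = d div k\<close>,
  about \<open>D / K\<close>. Arbitrary sequences \<open>d\<close> and \<open>D\<close> allow
  different choices for lower and upper limits.\<close>

lemma density_transfer:
  fixes d D :: "nat \<Rightarrow> nat"
  assumes kmr: "k \<ge> 1" "m \<ge> 1" "r \<ge> 1" and K: "K = m * k + r"
    and d: "filterlim d at_top sequentially" and D: "filterlim D at_top sequentially"
    and ratio: "(\<lambda>i. real (d i) / real (D i)) \<longlonglongrightarrow> real k / real K"
    and deg: "\<forall>\<^sub>F i in sequentially. m * (d i + 1) + r * (d i div k + 1) \<le> D i"
    and c: "c > 0" and \<delta>: "\<delta> < c ^ m * (real k ^ (m * k) / real K ^ K)"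
  shows "\<forall>\<^sub>F i in sequentially. c \<le> density k (d i) \<longrightarrow> \<delta> < density K (D i)"
proof -
  \<comment> \<open>The guaranteed order divided by \<open>c ^ m * D ^ K\<close>; it tends to
    \<open>(k / K) ^ (m * k) * (1 / K) ^ r\<close>.\<close>
  define w where "w i = (real (d i) / real (D i)) ^ (m * k) * (real (d i div k) / real (D i)) ^ r" for i
  have K1: "K \<ge> 1" using kmr K by auto
  have "w \<longlonglongrightarrow> (real k / real K) ^ (m * k) * (real k / real K / real k) ^ r"
    unfolding w_def by (intro tendsto_intros ratio div_div_tendsto D kmr)
  also have "(real k / real K) ^ (m * k) * (real k / real K / real k) ^ r = real k ^ (m * k) / real K ^ K"
    using kmr(1) by (simp add: K power_divide power_add)
  finally have w: "(\<lambda>i. c ^ m * w i) \<longlonglongrightarrow> c ^ m * (real k ^ (m * k) / real K ^ K)"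
    by (intro tendsto_intros)
  have pos: "c ^ m * (real k ^ (m * k) / real K ^ K) > 0" using c kmr(1) K1 by simp
  have "(\<lambda>i. real ((D i + 1) ^ (K - 1)) / real (D i) ^ K) \<longlonglongrightarrow> 0"
    by (rule filterlim_compose[OF power_Suc_div_power_tendsto_0[OF K1] D])
  from tendsto_diff[OF w this]
  have "(\<lambda>i. c ^ m * w i - real ((D i + 1) ^ (K - 1)) / real (D i) ^ K)
      \<longlonglongrightarrow> c ^ m * (real k ^ (m * k) / real K ^ K)" by simp
  then have "\<forall>\<^sub>F i in sequentially. 0 < c ^ m * w i - real ((D i + 1) ^ (K - 1)) / real (D i) ^ K"
    by (rule order_tendstoD) (rule pos)
  moreover have "\<forall>\<^sub>F i in sequentially. \<delta> < c ^ m * w i" using order_tendstoD(1)[OF w \<delta>] .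
  moreover have "\<forall>\<^sub>F i in sequentially. d i \<ge> 1" "\<forall>\<^sub>F i in sequentially. D i \<ge> 1"
    using d D by (auto simp: filterlim_at_top)
  ultimately show ?thesis using deg
  proof eventually_elim
    case (elim i)
    show ?case
    proof
      assume "c \<le> density k (d i)"
      then have "c * real (d i) ^ k \<le> real (f (d i) k)"
        using elim by (simp add: density_def field_simps)
      then have "(c * real (d i) ^ k) ^ m \<le> real (f (d i) k) ^ m"
        using c by (intro power_mono) auto
      then have "(c * real (d i) ^ k) ^ m * real (d i div k) ^ r \<le> real (f (d i) k ^ m * (d i div k) ^ r)"
        by (simp add: mult_right_mono)
      moreover have "(c * real (d i) ^ k) ^ m * real (d i div k) ^ r = c ^ m * w i * real (D i) ^ K"
        using elim by (simp add: w_def K power_mult_distrib power_divide power_add mult.commute[of m k] flip: power_mult)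
      ultimately have le: "c ^ m * w i * real (D i) ^ K \<le> real (f (d i) k ^ m * (d i div k) ^ r)" by simp
      \<comment> \<open>This is the size condition of \<open>product\<close>: the limit of
        \<open>c ^ m * w i\<close> is positive, while the certifying bound is of lower
        order.\<close>
      have "real ((D i + 1) ^ (K - 1)) < c ^ m * w i * real (D i) ^ K"
        using elim by (simp add: field_simps)
      with le have "real ((D i + 1) ^ (K - 1)) < real (f (d i) k ^ m * (d i div k) ^ r)" by linarith
      then have "(D i + 1) ^ (m * k + r - 1) < f (d i) k ^ m * (d i div k) ^ r"
        unfolding of_nat_less_iff K .
      from product[OF kmr _ this] elim have "f (d i) k ^ m * (d i div k) ^ r \<le> f (D i) K"
        unfolding K by simp
      then have "real (f (d i) k ^ m * (d i div k) ^ r) \<le> real (f (D i) K)" by (simp only: of_nat_le_iff)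
      with le have "c ^ m * w i \<le> density K (D i)"
        using elim by (simp add: density_def field_simps)
      then show "\<delta> < density K (D i)" using elim by linarith
    qed
  qed
qed

text \<open>Every large target degree must be served, so the source degree is chosen from the
  target. This is harmless, as almost all source degrees have density above
  \<open>c\<close>.\<close>

lemma liminf_density_transfer:
  assumes kmr: "k \<ge> 1" "m \<ge> 1" "r \<ge> 1" and K: "K = m * k + r"
    and c: "c > 0" "ereal c < liminf (density k)" and \<delta>: "\<delta> < c ^ m * (real k ^ (m * k) / real K ^ K)"
  shows "ereal \<delta> \<le> liminf (density K)"
proof (rule Liminf_bounded)
  \<comment> \<open>With source degree \<open>k * t\<close> the tower uses
    \<open>K * t + m + r\<close>; \<open>t\<close> is the largest value for which this is at most
    \<open>i\<close>, once \<open>i \<ge> m + r\<close>.\<close>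
  define t where "t i = (i - (m + r)) div K" for i :: nat
  have K1: "K \<ge> 1" using kmr K by auto
  have t: "filterlim t at_top sequentially"
    unfolding filterlim_at_top
  proof
    fix Z
    show "\<forall>\<^sub>F i in sequentially. Z \<le> t i"
      using eventually_ge_at_top[of "K * Z + (m + r)"]
    proof eventually_elim
      case (elim i)
      have "(K * Z) div K \<le> t i" unfolding t_def using elim by (intro div_le_mono) auto
      then show ?case using K1 by simp
    qed
  qed
  have "(\<lambda>i. 1 - real (min i (m + r)) / real i) \<longlonglongrightarrow> 1 - 0"
    by (intro tendsto_intros bounded_div_tendsto_0[of _ "m + r"] filterlim_ident) auto
  moreover have "\<forall>\<^sub>F i in sequentially. 1 - real (min i (m + r)) / real i = real (i - (m + r)) / real i"
    using eventually_gt_at_top[of "m + r"]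
    by eventually_elim (auto simp: field_simps min_def of_nat_diff)
  ultimately have "(\<lambda>i. real (i - (m + r)) / real i) \<longlonglongrightarrow> 1 - 0"
    by (rule Lim_transform_eventually)
  then have "(\<lambda>i. real (i - (m + r)) / real i) \<longlonglongrightarrow> 1" by simp
  from div_div_tendsto[OF this filterlim_ident K1]
  have "(\<lambda>i. real (t i) / real i) \<longlonglongrightarrow> 1 / real K" by (simp add: t_def)
  from tendsto_mult[OF tendsto_const[of "real k"] this]
  have ratio: "(\<lambda>i. real (k * t i) / real i) \<longlonglongrightarrow> real k / real K" by simp
  have kt: "filterlim (\<lambda>i. k * t i) at_top sequentially"
    by (rule filterlim_at_top_mono[OF t]) (use kmr in auto)
  have "\<forall>\<^sub>F i in sequentially. m * (k * t i + 1) + r * (k * t i div k + 1) \<le> i"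
    using eventually_ge_at_top[of "m + r"]
  proof eventually_elim
    case (elim i)
    have "K * t i \<le> i - (m + r)" unfolding t_def by simp
    with elim have "K * t i + (m + r) \<le> i" by linarith
    then show ?case using kmr(1) by (simp add: K algebra_simps)
  qed
  note density_transfer[OF kmr K kt filterlim_ident ratio this c(1) \<delta>]
  moreover have "\<forall>\<^sub>F i in sequentially. ereal c < density k (k * t i)"
    using kt less_LiminfD[OF c(2)] by (auto simp: filterlim_iff)
  ultimately show "\<forall>\<^sub>F i in sequentially. ereal \<delta> \<le> ereal (density K i)"
    by eventually_elim auto
qed

text \<open>Here the good source degrees are out of control, so the target degree is computed from
  the source.\<close>

lemma limsup_density_transfer:
  assumes kmr: "k \<ge> 1" "m \<ge> 1" "r \<ge> 1" and K: "K = m * k + r"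
    and c: "c > 0" "ereal c < limsup (density k)" and \<delta>: "\<delta> < c ^ m * (real k ^ (m * k) / real K ^ K)"
  shows "ereal \<delta> \<le> limsup (density K)"
proof (rule ccontr)
  assume "\<not> ?thesis"
  then have "\<forall>\<^sub>F D in sequentially. ereal (density K D) < ereal \<delta>"
    by (intro Limsup_lessD) auto
  have "K > 0" using kmr K by simp
  \<comment> \<open>The least degree that \<open>product\<close> permits for source degree
    \<open>i\<close>; its ratio to \<open>i\<close> tends to
    \<open>m + r / k = K / k\<close>.\<close>
  define D where "D i = m * (i + 1) + r * (i div k + 1)" for i
  have D: "filterlim D at_top sequentially"
  proof (rule filterlim_at_top_mono[OF filterlim_ident])
    have "i \<le> D i" for i using kmr(2) mult_le_mono1[of 1 m "i + 1"] by (simp add: D_def)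
    then show "\<forall>\<^sub>F i in sequentially. i \<le> D i" by simp
  qed
  have "(\<lambda>i. real i / real i) \<longlonglongrightarrow> 1"
    by (rule tendsto_eventually) (use eventually_gt_at_top[of 0] in eventually_elim, auto)
  note quot = this div_div_tendsto[OF this filterlim_ident kmr(1)]
  have bdd: "(\<lambda>i. real (m + r) / real i) \<longlonglongrightarrow> 0"
    by (intro bounded_div_tendsto_0 filterlim_ident) auto
  have "(\<lambda>i. real m * (real i / real i) + real r * (real (i div k) / real i) + real (m + r) / real i)
      \<longlonglongrightarrow> real m * 1 + real r * (1 / real k) + 0"
    by (intro tendsto_intros quot bdd)
  also have "real m * 1 + real r * (1 / real k) + 0 = real K / real k"
    using kmr(1) by (simp add: K field_simps)
  also have "(\<lambda>i. real m * (real i / real i) + real r * (real (i div k) / real i) + real (m + r) / real i)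
      = (\<lambda>i. real (D i) / real i)"
    by (auto simp: D_def field_simps add_divide_distrib)
  finally have "(\<lambda>i. inverse (real (D i) / real i)) \<longlonglongrightarrow> inverse (real K / real k)"
    using kmr(1) \<open>K > 0\<close> by (intro tendsto_inverse) auto
  then have ratio: "(\<lambda>i. real i / real (D i)) \<longlonglongrightarrow> real k / real K" by simp
  have "\<forall>\<^sub>F i in sequentially. m * (i + 1) + r * (i div k + 1) \<le> D i" by (simp add: D_def)
  note density_transfer[OF kmr K filterlim_ident D ratio this c(1) \<delta>]
  moreover have "\<forall>\<^sub>F i in sequentially. ereal (density K (D i)) < ereal \<delta>"
    using D \<open>\<forall>\<^sub>F D in sequentially. ereal (density K D) < ereal \<delta>\<close> by (auto simp: filterlim_iff)
  \<comment> \<open>Contraposition of \<open>density_transfer\<close>: sparse targets force sparse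
    sources at all large degrees.\<close>
  ultimately have "\<forall>\<^sub>F i in sequentially. ereal (density k i) \<le> ereal c"
    by eventually_elim auto
  then have "limsup (density k) \<le> ereal c" by (rule Limsup_bounded)
  with c(2) show False by simp
qed

lemma limsup_density_le: "limsup (density k) \<le> ereal (1 / fact k)"
proof -
  have "\<forall>\<^sub>F d in sequentially. ereal (density k d) \<le> ereal ((1 + real k * inverse (real d)) ^ k / fact k)"
    using eventually_gt_at_top[of 0]
  proof eventually_elim
    case (elim d)
    have "f d k * fact k \<le> (d + k) ^ k"
      using mult_le_mono1[OF le_binomial[of d k], of "fact k"] binomial_fact_pow[of "d + k" k]
      by linarith
    then have "real (f d k) * fact k \<le> real (d + k) ^ k"
      by (metis of_nat_fact of_nat_le_iff of_nat_mult of_nat_power)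
    then have "density k d \<le> (real (d + k) / real d) ^ k / fact k"
      using elim by (simp add: density_def power_divide divide_simps mult.commute)
    also have "real (d + k) / real d = 1 + real k * inverse (real d)"
      using elim by (simp add: field_simps)
    finally show ?case by simp
  qed
  then have "limsup (density k) \<le> limsup (\<lambda>d. ereal ((1 + real k * inverse (real d)) ^ k / fact k))"
    by (rule Limsup_mono)
  also have "(\<lambda>d. (1 + real k * inverse (real d)) ^ k / fact k) \<longlonglongrightarrow> (1 + real k * 0) ^ k / fact k"
    by (intro tendsto_intros lim_inverse_n) auto
  then have "limsup (\<lambda>d. ereal ((1 + real k * inverse (real d)) ^ k / fact k)) = ereal ((1 + real k * 0) ^ k / fact k)"
    by (intro lim_imp_Limsup) auto
  finally show ?thesis by simp
qed

end

interpretation directed: order_function DCC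
  using DCC_product DCC_le_binomial by (rule order_function.intro)

interpretation undirected: order_function CC
  using CC_product CC_le_binomial by (rule order_function.intro)

section \<open>From the inequality between densities to the limit\<close>

text \<open>The left-hand side divided by \<open>fact k\<close> is a single term of the exponential
  series; this bounds \<open>R\<close> by \<open>exp 1\<close>.\<close>

lemma power_le_exp_fact: "real k ^ k \<le> exp (real k) * fact k"
proof -
  have "(\<Sum>n\<in>{k}. real k ^ n /\<^sub>R fact n) \<le> (\<Sum>n. real k ^ n /\<^sub>R fact n)"
    by (intro sum_le_suminf summable_exp_generic) auto
  then show ?thesis by (simp add: exp_def field_simps)
qed

lemma sup_limit_if_supermultiplicative:
  fixes l R :: "nat \<Rightarrow> real"
  assumes nonneg: "\<And>k. 0 \<le> l k" and upper: "\<And>k. l k \<le> 1 / fact k"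
    and super: "\<And>k m r K. k \<ge> 1 \<Longrightarrow> m \<ge> 1 \<Longrightarrow> r \<ge> 1 \<Longrightarrow> K = m * k + r \<Longrightarrow>
      l k ^ m * (real k ^ (m * k) / real K ^ K) \<le> l K"
    and R: "\<And>k. R k = real k * l k powr (1 / real k)"
  shows "bdd_above (R ` {1..}) \<and> R \<longlonglongrightarrow> (SUP k\<in>{1..}. R k)"
proof
  have R0: "R k \<ge> 0" for k by (simp add: R)
  have Rpow: "R k ^ k = real k ^ k * l k" if "k \<ge> 1" for k
    using that nonneg[of k] by (cases "l k = 0") (simp_all add: R power_mult_distrib powr_power power_0_left)
  have "R k \<le> exp 1" if "k \<ge> 1" for k
  proof (rule power_le_imp_le_base)
    have "R k ^ k \<le> real k ^ k * (1 / fact k)"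
      unfolding Rpow[OF that] by (intro mult_left_mono upper) auto
    also have "\<dots> \<le> exp (real k)" using power_le_exp_fact[of k] by (simp add: field_simps)
    also have "\<dots> = exp 1 ^ k" by (simp flip: exp_of_nat_mult)
    finally show "R k ^ Suc (k - 1) \<le> exp 1 ^ Suc (k - 1)" using that by simp
  qed simp
  then show bdd: "bdd_above (R ` {1..})" by (auto simp: bdd_above_def)
  \<comment> \<open>Each \<open>R k\<close> is an asymptotic lower bound for \<open>R\<close>.
    Together with the trivial upper bound by the supremum this yields the limit.\<close>
  have key: "\<forall>\<^sub>F K in sequentially. y < R K" if k: "k \<ge> 1" and y: "y < R k" for k y
  proof (cases "R k = 0")
    case True
    then show ?thesis using y R0 by (auto intro: always_eventually less_le_trans)
  next
    case False
    then have pos: "R k > 0" using R0[of k] by simp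
    \<comment> \<open>The exponent \<open>m * k / K\<close> for \<open>K = m * k + r\<close>.
      Dividing \<open>K - 1\<close> instead of \<open>K\<close> puts \<open>r\<close> between
      \<open>1\<close> and \<open>k\<close>, so it is never \<open>0\<close>.\<close>
    define e where "e K = real ((K - 1) div k * k) / real K" for K
    have "(\<lambda>K. 1 - real ((K - 1) mod k + 1) / real K) \<longlonglongrightarrow> 1 - 0"
      using k by (intro tendsto_intros bounded_div_tendsto_0[of _ k] filterlim_ident) (simp add: Suc_leI)
    moreover have "\<forall>\<^sub>F K in sequentially. 1 - real ((K - 1) mod k + 1) / real K = e K"
      using eventually_gt_at_top[of 0]
    proof eventually_elim
      case (elim K)
      have "K = (K - 1) div k * k + ((K - 1) mod k + 1)" using elim by simp
      then have "real K = real ((K - 1) div k * k) + real ((K - 1) mod k + 1)"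
        by (metis of_nat_add)
      then show ?case using elim by (simp add: e_def field_simps)
    qed
    ultimately have "e \<longlonglongrightarrow> 1 - 0" by (rule Lim_transform_eventually)
    then have "e \<longlonglongrightarrow> 1" by simp
    then have "(\<lambda>K. R k powr e K) \<longlonglongrightarrow> R k powr 1" using pos by (intro tendsto_powr) auto
    then have "\<forall>\<^sub>F K in sequentially. y < R k powr e K"
      by (rule order_tendstoD) (use pos y in simp)
    moreover have "\<forall>\<^sub>F K in sequentially. R k powr e K \<le> R K"
      using eventually_gt_at_top[of k]
    proof eventually_elim
      case (elim K)
      define m r where "m = (K - 1) div k" and "r = (K - 1) mod k + 1"
      have mr: "m \<ge> 1" "r \<ge> 1" "K = m * k + r"
        using elim k by (auto simp: m_def r_def div_greater_zero_iff Suc_le_eq)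
      \<comment> \<open>Multiplied by \<open>K ^ K\<close>, the hypothesis \<open>super\<close>
        reads \<open>R k ^ (m * k) \<le> R K ^ K\<close>; the \<open>K\<close>-th root
        follows.\<close>
      have "R k ^ (m * k) = (R k ^ k) ^ m" by (metis mult.commute power_mult)
      also have "\<dots> = (real k ^ k * l k) ^ m" by (simp only: Rpow[OF k])
      also have "\<dots> = real K ^ K * (l k ^ m * (real k ^ (m * k) / real K ^ K))"
        using elim by (simp add: power_mult_distrib power_mult[of _ k m] mult.commute[of m k])
      also have "\<dots> \<le> real K ^ K * l K" using super[OF k mr] by (intro mult_left_mono) auto
      also have "\<dots> = R K ^ K" using Rpow[of K] mr by simp
      finally have "(R k ^ (m * k)) powr (1 / real K) \<le> (R K ^ K) powr (1 / real K)"
        using R0 by (intro powr_mono2) auto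
      moreover have "(R k ^ (m * k)) powr (1 / real K) = R k powr e K"
        using pos by (simp add: e_def m_def powr_powr flip: powr_realpow)
      moreover have "(R K ^ K) powr (1 / real K) = R K"
        using R0[of K] elim by (cases "R K = 0") (simp_all add: powr_powr power_0_left flip: powr_realpow)
      ultimately show ?case by simp
    qed
    ultimately show ?thesis by eventually_elim simp
  qed
  show "R \<longlonglongrightarrow> (SUP k\<in>{1..}. R k)"
  proof (rule order_tendstoI)
    fix y assume "y < (SUP k\<in>{1..}. R k)"
    then obtain k where "k \<ge> 1" "y < R k" using bdd by (subst (asm) less_cSUP_iff) auto
    then show "\<forall>\<^sub>F K in sequentially. y < R K" by (rule key)
  next
    fix y assume y: "(SUP k\<in>{1..}. R k) < y"
    show "\<forall>\<^sub>F K in sequentially. R K < y"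
      using eventually_ge_at_top[of 1]
    proof eventually_elim
      case (elim K)
      then have "R K \<le> (SUP k\<in>{1..}. R k)" using bdd by (intro cSUP_upper) auto
      with y show ?case by simp
    qed
  qed
qed

text \<open>The transfer lemmas need strict inequalities for \<open>c\<close> and
  \<open>\<delta>\<close>. Let \<open>\<delta>\<close> rise to \<open>c ^ m * W\<close>, then
  \<open>c\<close> to \<open>l\<close>; for \<open>l = 0\<close> no such \<open>c\<close> exists,
  but \<open>m \<ge> 1\<close> makes the claim trivial.\<close>

lemma power_mult_le_if_dense:
  fixes l W l' :: real
  assumes "0 \<le> l" "0 \<le> l'" "0 < W" "m \<ge> 1"
    and le: "\<And>c \<delta>. 0 < c \<Longrightarrow> c < l \<Longrightarrow> \<delta> < c ^ m * W \<Longrightarrow> \<delta> \<le> l'"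
  shows "l ^ m * W \<le> l'"
proof (cases "l = 0")
  case True
  then show ?thesis using assms(2,4) by (simp add: power_0_left)
next
  case False
  then have "0 < l" using assms(1) by simp
  have "((\<lambda>c. c ^ m * W) \<longlongrightarrow> l ^ m * W) (at_left l)" by (intro tendsto_intros)
  moreover have "\<forall>\<^sub>F c in at_left l. c ^ m * W \<le> l'"
    using eventually_at_left_real[OF \<open>0 < l\<close>]
    by eventually_elim (rule dense_le, rule le, auto)
  ultimately show ?thesis by (rule tendsto_upperbound) simp
qed

theorem theorem15:
  fixes L :: "nat \<Rightarrow> ereal" and R :: "nat \<Rightarrow> real"
  assumes "L \<in> {LC_minus, LC_plus, LD_minus, LD_plus}"
    and "\<And>k. R k = real k * real_of_ereal (L k) powr (1 / real k)"
  shows "bdd_above (R ` {1..}) \<and> R \<longlonglongrightarrow> (SUP k\<in>{1..}. R k)"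
proof (rule sup_limit_if_supermultiplicative[of "\<lambda>k. real_of_ereal (L k)"])
  have L_range: "L k \<in> {0..ereal (2 ^ k)}" for k using assms(1) limits_bounds[of k] by auto
  then have L_real: "L k = ereal (real_of_ereal (L k))" for k
    by (intro ereal_real'[symmetric]) (use L_range[of k] in \<open>cases "L k"; auto\<close>)
  show nonneg: "0 \<le> real_of_ereal (L k)" for k using L_range[of k] by (auto intro: real_of_ereal_pos)
  have L_unfold: "LC_minus k = liminf (undirected.density k)" "LC_plus k = limsup (undirected.density k)"
    "LD_minus k = liminf (directed.density k)" "LD_plus k = limsup (directed.density k)" for k
    by (simp_all add: LC_minus_def LC_plus_def LD_minus_def LD_plus_def
      undirected.density_def directed.density_def)
  \<comment> \<open>The bound on the upper limits also covers the lower ones.\<close>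
  have "L k \<le> ereal (1 / fact k)" for k
    using assms(1) undirected.limsup_density_le[of k] directed.limsup_density_le[of k]
    by (auto simp: L_unfold intro: order_trans[OF liminf_le_limsup_seq])
  then show "real_of_ereal (L k) \<le> 1 / fact k" for k
    by (metis L_real ereal_less_eq(3))
  show "real_of_ereal (L k) ^ m * (real k ^ (m * k) / real K ^ K) \<le> real_of_ereal (L K)"
    if kmr: "k \<ge> 1" "m \<ge> 1" "r \<ge> 1" "K = m * k + r" for k m r K
  proof (rule power_mult_le_if_dense[OF nonneg nonneg _ kmr(2)])
    have "K > 0" using kmr by simp
    then show "0 < real k ^ (m * k) / real K ^ K" using kmr(1) by simp
    fix c \<delta> assume c: "0 < c" "c < real_of_ereal (L k)"
      and \<delta>: "\<delta> < c ^ m * (real k ^ (m * k) / real K ^ K)"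
    have "ereal c < L k" using c(2) by (subst L_real) simp
    then have "ereal \<delta> \<le> L K"
      using assms(1) undirected.liminf_density_transfer[OF kmr c(1) _ \<delta>]
        undirected.limsup_density_transfer[OF kmr c(1) _ \<delta>]
        directed.liminf_density_transfer[OF kmr c(1) _ \<delta>]
        directed.limsup_density_transfer[OF kmr c(1) _ \<delta>]
      by (auto simp: L_unfold)
    then show "\<delta> \<le> real_of_ereal (L K)" by (metis L_real ereal_less_eq(3))
  qed
qed (rule assms(2))

end
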